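(* For every integer $r\ge 5$ and every integer $n\ge r\,2^r\,2^{2^r}$, there exists an $r$-ample simplicial complex having exactly $n$ vertices.
   Context: For a simplicial complex $X$, $V(X)$ is its vertex set; for $U\subseteq V(X)$, $X_U$ is the induced subcomplex on $U$ (vertex set $U$, whose simplices are exactly the simplices of $X$ with all vertices in $U$). For a vertex $v$, the link ${\rm lk}_X(v)$ is the subcomplex of all simplices $\sigma$ of $X$ with $v\notin\sigma$ such that $\sigma\cup\{v\}$ is a simplex of $X$. Subcomplexes are allowed to be empty. For an integer $r\ge 1$, a nonempty simplicial complex $X$ is $r$-ample if for each $U\subseteq V(X)$ with $|U|\le r$ and each subcomplex $A\subseteq X_U$ (possibly empty) there is a vertex $v\in V(X)\setminus U$ with ${\rm lk}_X(v)\cap X_U=A$. *)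

theory Defs
  imports Main
begin

(* An abstract simplicial complex is identified with its set of simplices, which are nonempty
   finite sets.  The empty set is not a simplex, so the empty complex is {}, and it has no
   vertices.  Every vertex is (as a singleton) a simplex, so the vertex set is the union. *)

definition abstract_simplicial_complex :: "'a set set \<Rightarrow> bool" where
  "abstract_simplicial_complex X \<longleftrightarrow>
     (\<forall>\<sigma>\<in>X. finite \<sigma> \<and> \<sigma> \<noteq> {}) \<and>
     (\<forall>\<sigma>\<in>X. \<forall>\<tau>. \<tau> \<noteq> {} \<and> \<tau> \<subseteq> \<sigma> \<longrightarrow> \<tau> \<in> X)"

definition vertices :: "'a set set \<Rightarrow> 'a set" where
  "vertices X = \<Union>X"

definition subcomplex :: "'a set set \<Rightarrow> 'a set set \<Rightarrow> bool" where
  "subcomplex A X \<longleftrightarrow> abstract_simplicial_complex A \<and> A \<subseteq> X"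

definition induced_subcomplex :: "'a set set \<Rightarrow> 'a set \<Rightarrow> 'a set set" where
  "induced_subcomplex X U = {\<sigma> \<in> X. \<sigma> \<subseteq> U}"

definition link :: "'a set set \<Rightarrow> 'a \<Rightarrow> 'a set set" where
  "link X v = {\<sigma> \<in> X. v \<notin> \<sigma> \<and> \<sigma> \<union> {v} \<in> X}"

(* A subcomplex A of the induced complex on U need not contain all of U as vertices. *)

definition ample :: "nat \<Rightarrow> 'a set set \<Rightarrow> bool" where
  "ample r X \<longleftrightarrow>
     abstract_simplicial_complex X \<and> X \<noteq> {} \<and>
     (\<forall>U A. U \<subseteq> vertices X \<and> finite U \<and> card U \<le> r \<and> subcomplex A (induced_subcomplex X U) \<longrightarrow>
        (\<exists>v \<in> vertices X - U. link X v \<inter> induced_subcomplex X U = A))"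

lemma vertices_iff_singleton:
  assumes "abstract_simplicial_complex X"
  shows "v \<in> vertices X \<longleftrightarrow> {v} \<in> X"
proof
  assume "v \<in> vertices X"
  then obtain \<sigma> where "\<sigma> \<in> X" "{v} \<subseteq> \<sigma>" "{v} \<noteq> {}"
    by (auto simp: vertices_def)
  with assms show "{v} \<in> X"
    unfolding abstract_simplicial_complex_def by metis
qed (auto simp: vertices_def)

lemma vertices_induced_subcomplex:
  assumes "abstract_simplicial_complex X" and "U \<subseteq> vertices X"
  shows "vertices (induced_subcomplex X U) = U"
proof
  show "U \<subseteq> vertices (induced_subcomplex X U)"
  proof
    fix v assume "v \<in> U"
    with assms have "{v} \<in> induced_subcomplex X U"
      by (auto simp: induced_subcomplex_def vertices_iff_singleton[symmetric])
    then show "v \<in> vertices (induced_subcomplex X U)"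
      by (auto simp: vertices_def)
  qed
qed (auto simp: induced_subcomplex_def vertices_def)

end

theory Submission
  imports Defs Complex_Main "HOL-Library.Disjoint_Sets"
begin

(* The probabilistic method, phrased as counting. Choose a family F of subsets of
   {..<n} uniformly and let X consist of the nonempty sets all of whose subsets with at least two
   elements lie in F. Fix U with r elements and a target A. A vertex v outside U realises A as soon
   as F contains insert v s exactly for those nonempty s in U that belong to A; this prescribes
   F on 2^r - 1 sets, and these sets are different for different v. Hence the proportion of F for
   which no v works is (1 - 2^(1 - 2^r))^(n - r), and a union bound over at most
   n^r * 2^(2^r - 1) pairs (U, A) leaves some F for which every pair is realised. *)

section \<open>Counting families that avoid prescribed traces on disjoint blocks\<close>

text \<open>Traces of a uniform \<open>F\<close> on disjoint blocks are independent, and each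
  differs from its prescribed pattern with probability \<open>1 - 1 / 2 ^ m\<close>. The induction
  splits off one block at a time, so \<open>S\<close> has to vary.\<close>

lemma card_avoiding_patterns:
  fixes B P :: "'i \<Rightarrow> 'a set"
  assumes "finite W" "finite S"
    and "\<And>v. v \<in> W \<Longrightarrow> B v \<subseteq> S" "\<And>v. v \<in> W \<Longrightarrow> P v \<subseteq> B v" "\<And>v. v \<in> W \<Longrightarrow> card (B v) = m"
    and "disjoint_family_on B W"
  shows "real (card {F. F \<subseteq> S \<and> (\<forall>v\<in>W. F \<inter> B v \<noteq> P v)}) \<le> 2 ^ card S * (1 - 1 / 2 ^ m) ^ card W"
  using assms
proof (induction W arbitrary: S rule: finite_induct)
  case empty
  have "{F. F \<subseteq> S} = Pow S" by auto
  with empty show ?case by (simp add: card_Pow)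
next
  case (insert w W)
  let ?E = "{F. F \<subseteq> S \<and> (\<forall>v\<in>insert w W. F \<inter> B v \<noteq> P v)}"
  let ?E' = "{F. F \<subseteq> S - B w \<and> (\<forall>v\<in>W. F \<inter> B v \<noteq> P v)}"
  have Bw: "B w \<subseteq> S" "P w \<subseteq> B w" "card (B w) = m" using insert.prems by auto
  have fin: "finite (B w)" using Bw insert.prems(1) finite_subset by blast
  have disj: "B v \<inter> B w = {}" if "v \<in> W" for v
    using insert.prems(5) insert.hyps(2) that unfolding disjoint_family_on_def by auto
  have IH: "real (card ?E') \<le> 2 ^ card (S - B w) * (1 - 1 / 2 ^ m) ^ card W"
  proof (rule insert.IH)
    show "B v \<subseteq> S - B w" if "v \<in> W" for v using disj[OF that] insert.prems(2) that by auto
    show "disjoint_family_on B W"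
      using insert.prems(5) by (auto simp: disjoint_family_on_def)
  qed (use insert.prems in auto)
  \<comment> \<open>The trace on \<open>B w\<close> can take at most \<open>2 ^ m - 1\<close>
    values; the remainder still satisfies the other constraints, because their blocks do not meet
    \<open>B w\<close>.\<close>
  let ?f = "\<lambda>F. (F \<inter> B w, F - B w)"
  have "inj_on ?f ?E" by (rule inj_onI) blast
  moreover have "?f ` ?E \<subseteq> (Pow (B w) - {P w}) \<times> ?E'"
  proof
    fix y assume "y \<in> ?f ` ?E"
    then obtain F where F: "F \<in> ?E" "y = ?f F" by blast
    have "(F - B w) \<inter> B v = F \<inter> B v" if "v \<in> W" for v using disj[OF that] by auto
    then show "y \<in> (Pow (B w) - {P w}) \<times> ?E'" using F by auto
  qed
  moreover have "finite ((Pow (B w) - {P w}) \<times> ?E')" using fin insert.prems(1) by simp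
  ultimately have "card ?E \<le> card ((Pow (B w) - {P w}) \<times> ?E')"
    by (metis (no_types, lifting) card_image card_mono)
  also have "\<dots> = (2 ^ m - 1) * card ?E'"
    using Bw fin by (simp add: card_cartesian_product card_Pow card_Diff_subset)
  finally have "real (card ?E) \<le> real ((2 ^ m - 1) * card ?E')" by linarith
  also have "\<dots> = (2 ^ m - 1) * real (card ?E')" by (simp add: of_nat_diff)
  also have "\<dots> \<le> (2 ^ m - 1) * (2 ^ card (S - B w) * (1 - 1 / 2 ^ m) ^ card W)"
    by (rule mult_left_mono[OF IH]) simp
  also have "\<dots> = (2 ^ m * 2 ^ card (S - B w)) * ((1 - 1 / 2 ^ m) * (1 - 1 / 2 ^ m) ^ card W)"
    by (simp add: field_simps)
  also have "2 ^ m * 2 ^ card (S - B w) = (2 ^ card S :: real)"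
    using Bw fin insert.prems(1) card_mono[OF insert.prems(1) Bw(1)]
    by (simp add: card_Diff_subset flip: power_add)
  finally show ?case using insert.hyps by simp
qed

section \<open>Extension patterns and the union bound\<close>

definition extension_block :: "'a set \<Rightarrow> 'a \<Rightarrow> 'a set set" where
  "extension_block U v = insert v ` (Pow U - {{}})"

lemma card_extension_block:
  assumes "finite U" "v \<notin> U"
  shows "card (extension_block U v) = 2 ^ card U - 1"
proof -
  have "inj_on (insert v) (Pow U - {{}})"
    using assms(2) by (intro inj_onI) (metis DiffD1 PowD insert_ident subsetD)
  then show ?thesis
    using assms by (simp add: extension_block_def card_image card_Diff_subset card_Pow)
qed

text \<open>Each member of the block of \<open>v\<close> has \<open>v\<close> as its only element
  outside \<open>U\<close>, so it determines \<open>v\<close>.\<close>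

lemma extension_block_disjoint:
  assumes "W \<inter> U = {}"
  shows "disjoint_family_on (extension_block U) W"
  using assms unfolding disjoint_family_on_def extension_block_def by blast

text \<open>Here \<open>A\<close> is any family of nonempty subsets of \<open>U\<close>, rather than
  a subcomplex of a complex built from \<open>F\<close>: the pairs \<open>(U, A)\<close> are then
  fixed independently of \<open>F\<close>, as the union bound requires.\<close>

definition realises_patterns :: "nat \<Rightarrow> 'a set \<Rightarrow> 'a set set \<Rightarrow> bool" where
  "realises_patterns r V F \<longleftrightarrow>
     (\<forall>U A. U \<subseteq> V \<and> card U = r \<and> A \<subseteq> Pow U - {{}} \<longrightarrow>
        (\<exists>v\<in>V - U. F \<inter> extension_block U v = insert v ` A))"

text \<open>The left side of \<open>small\<close> bounds the expected number of pairs
  \<open>(U, A)\<close> that a uniform \<open>F\<close> leaves unrealised; being below 1, it allows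
  some \<open>F\<close> with no such pair.\<close>

lemma exists_realising_family:
  fixes V :: "'a set"
  assumes "finite V"
    and small: "real (card V) ^ r * 2 ^ (2 ^ r - 1) * (1 - 1 / 2 ^ (2 ^ r - 1)) ^ (card V - r) < 1"
  shows "\<exists>F. realises_patterns r V F"
proof (rule ccontr)
  assume none: "\<not> ?thesis"
  define m where "m = (2::nat) ^ r - 1"
  define D where "D = (SIGMA U:{U. U \<subseteq> V \<and> card U = r}. Pow (Pow U - {{}}))"
  define Bad where "Bad = (\<lambda>(U, A). {F. F \<subseteq> Pow V \<and> (\<forall>v\<in>V - U. F \<inter> extension_block U v \<noteq> insert v ` A)})"
  have finU: "finite U" if "U \<subseteq> V" for U using that assms(1) finite_subset by blast
  have finD: "finite D" unfolding D_def using assms(1) finU by (intro finite_SigmaI) auto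
  have "card D = (\<Sum>U\<in>{U. U \<subseteq> V \<and> card U = r}. card (Pow (Pow U - {{}})))"
    unfolding D_def using assms(1) finU by (intro card_SigmaI) auto
  also have "\<dots> = (\<Sum>U\<in>{U. U \<subseteq> V \<and> card U = r}. 2 ^ m)"
    using finU by (intro sum.cong) (auto simp: card_Pow card_Diff_subset m_def)
  also have "\<dots> = (card V choose r) * 2 ^ m"
    using assms(1) by (simp add: n_subsets)
  also have "\<dots> \<le> card V ^ r * 2 ^ m"
  proof (cases "r \<le> card V")
    case True
    then show ?thesis by (simp add: binomial_le_pow)
  qed (simp add: binomial_eq_0)
  finally have "real (card D) \<le> real (card V ^ r * 2 ^ m)" by (rule of_nat_mono)
  then have cardD: "real (card D) \<le> real (card V) ^ r * 2 ^ m" by simp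
  have bad: "real (card (Bad d)) \<le> 2 ^ card (Pow V) * (1 - 1 / 2 ^ m) ^ (card V - r)"
    if "d \<in> D" for d
  proof -
    obtain U A where dUA: "d = (U, A)" by (cases d)
    with that have d: "d = (U, A)" "U \<subseteq> V" "card U = r" "A \<subseteq> Pow U - {{}}"
      unfolding D_def by auto
    have "real (card {F. F \<subseteq> Pow V \<and> (\<forall>v\<in>V - U. F \<inter> extension_block U v \<noteq> insert v ` A)})
      \<le> 2 ^ card (Pow V) * (1 - 1 / 2 ^ m) ^ card (V - U)"
    proof (rule card_avoiding_patterns)
      show "disjoint_family_on (extension_block U) (V - U)"
        by (rule extension_block_disjoint) auto
      show "extension_block U v \<subseteq> Pow V" if "v \<in> V - U" for v
        using that d by (auto simp: extension_block_def)
      show "card (extension_block U v) = m" if "v \<in> V - U" for v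
        using that d finU by (auto simp: card_extension_block m_def)
      show "insert v ` A \<subseteq> extension_block U v" for v
        using d by (auto simp: extension_block_def)
    qed (use assms in auto)
    also have "card (V - U) = card V - r" using d finU by (simp add: card_Diff_subset)
    finally show ?thesis by (simp add: Bad_def d)
  qed
  \<comment> \<open>If every family fails at some pair, the bad sets cover all
    \<open>2 ^ card (Pow V)\<close> families, which is more than their sizes add up to.\<close>
  have "Pow (Pow V) \<subseteq> (\<Union>d\<in>D. Bad d)"
  proof
    fix F assume F: "F \<in> Pow (Pow V)"
    have "\<not> realises_patterns r V F" using none by blast
    then obtain U A where "U \<subseteq> V" "card U = r" "A \<subseteq> Pow U - {{}}"
      "\<forall>v\<in>V - U. F \<inter> extension_block U v \<noteq> insert v ` A"
      unfolding realises_patterns_def not_all not_imp bex_simps by (elim exE conjE)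
    then have "(U, A) \<in> D" "F \<in> Bad (U, A)" using F by (auto simp: D_def Bad_def)
    then show "F \<in> (\<Union>d\<in>D. Bad d)" by blast
  qed
  moreover have "finite (Bad d)" for d
    by (rule finite_subset[of _ "Pow (Pow V)"]) (use assms(1) in \<open>auto simp: Bad_def\<close>)
  ultimately have "card (Pow (Pow V)) \<le> card (\<Union>d\<in>D. Bad d)"
    using finD by (intro card_mono) auto
  also have "\<dots> \<le> (\<Sum>d\<in>D. card (Bad d))" by (rule card_UN_le[OF finD])
  finally have "real (card (Pow (Pow V))) \<le> real (\<Sum>d\<in>D. card (Bad d))" by (rule of_nat_mono)
  then have "2 ^ card (Pow V) \<le> (\<Sum>d\<in>D. real (card (Bad d)))"
    using assms(1) card_Pow[of "Pow V"] by simp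
  also have "\<dots> \<le> real (card D) * (2 ^ card (Pow V) * (1 - 1 / 2 ^ m) ^ (card V - r))"
    by (rule sum_bounded_above[OF bad])
  also have "\<dots> \<le> (real (card V) ^ r * 2 ^ m) * (2 ^ card (Pow V) * (1 - 1 / 2 ^ m) ^ (card V - r))"
    by (rule mult_right_mono[OF cardD]) simp
  also have "\<dots> = 2 ^ card (Pow V) * (real (card V) ^ r * 2 ^ m * (1 - 1 / 2 ^ m) ^ (card V - r))"
    by (simp add: mult_ac)
  also have "\<dots> < 2 ^ card (Pow V) * 1"
    by (rule mult_strict_left_mono) (use small in \<open>simp_all add: m_def\<close>)
  finally show False by simp
qed

section \<open>From families to ample complexes\<close>

text \<open>Testing all subsets \<open>\<tau>\<close> forces closure under faces for arbitrary
  \<open>F\<close>; exempting singletons makes every point of \<open>V\<close> a vertex.\<close>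

definition spanned_complex :: "'a set \<Rightarrow> 'a set set \<Rightarrow> 'a set set" where
  "spanned_complex V F = {\<sigma>. \<sigma> \<subseteq> V \<and> \<sigma> \<noteq> {} \<and> (\<forall>\<tau>. \<tau> \<subseteq> \<sigma> \<and> card \<tau> \<ge> 2 \<longrightarrow> \<tau> \<in> F)}"

lemma vertices_spanned_complex: "vertices (spanned_complex V F) = V"
proof -
  have "{v} \<in> spanned_complex V F" if "v \<in> V" for v
  proof -
    have "\<not> card \<tau> \<ge> 2" if "\<tau> \<subseteq> {v}" for \<tau> using card_mono[OF _ that] by simp
    then show ?thesis using that unfolding spanned_complex_def by blast
  qed
  then show ?thesis by (auto simp: vertices_def) (auto simp: spanned_complex_def)
qed

lemma link_spanned_complex:
  assumes "finite U" "v \<in> V - U"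
    and A: "subcomplex A (induced_subcomplex (spanned_complex V F) U)"
    and F: "F \<inter> extension_block U v = insert v ` A"
  shows "link (spanned_complex V F) v \<inter> induced_subcomplex (spanned_complex V F) U = A"
    (is "link ?X v \<inter> ?XU = A")
proof (rule set_eqI, rule iffI)
  have sub: "\<sigma> \<subseteq> U" "\<sigma> \<noteq> {}" "\<sigma> \<in> ?X" if "\<sigma> \<in> A" for \<sigma>
    using A that by (auto simp: subcomplex_def induced_subcomplex_def spanned_complex_def)
  fix \<sigma>
  {
    assume "\<sigma> \<in> link ?X v \<inter> ?XU"
    then have \<sigma>: "\<sigma> \<subseteq> U" "\<sigma> \<noteq> {}" "insert v \<sigma> \<in> ?X" "v \<notin> \<sigma>"
      by (auto simp: link_def induced_subcomplex_def spanned_complex_def)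
    \<comment> \<open>Nonemptiness of \<open>\<sigma>\<close> gives \<open>insert v \<sigma>\<close>
      at least two elements, so its membership in \<open>F\<close> is actually tested.\<close>
    have fin: "finite \<sigma>" using \<sigma>(1) assms(1) finite_subset by blast
    with \<sigma> have "card \<sigma> \<noteq> 0" by simp
    then have "card \<sigma> \<ge> 1" by linarith
    with \<sigma> fin have "card (insert v \<sigma>) \<ge> 2" by simp
    then have "insert v \<sigma> \<in> F" using \<sigma>(3) by (auto simp: spanned_complex_def)
    then have "insert v \<sigma> \<in> F \<inter> extension_block U v"
      using \<sigma> by (auto simp: extension_block_def)
    then obtain \<rho> where \<rho>: "\<rho> \<in> A" "insert v \<sigma> = insert v \<rho>" using F by auto
    then have "v \<notin> \<rho>" using sub assms(2) by auto
    then show "\<sigma> \<in> A" using \<rho> \<sigma>(4) insert_ident by metis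
  }
  assume "\<sigma> \<in> A"
  note \<sigma> = sub[OF this]
  \<comment> \<open>Faces without \<open>v\<close> are faces of the simplex \<open>\<sigma>\<close>.
    For the others, closure of \<open>A\<close> under faces puts \<open>\<tau> - {v}\<close> in
    \<open>A\<close>, and the pattern at \<open>v\<close> then puts \<open>\<tau>\<close> in
    \<open>F\<close>.\<close>
  have "\<tau> \<in> F" if \<tau>: "\<tau> \<subseteq> insert v \<sigma>" "card \<tau> \<ge> 2" for \<tau>
  proof (cases "v \<in> \<tau>")
    case False
    then show ?thesis using \<tau> \<sigma>(3) by (auto simp: spanned_complex_def subset_insert)
  next
    case True
    have nonempty: "\<tau> - {v} \<noteq> {}"
    proof
      assume "\<tau> - {v} = {}"
      with True have "\<tau> = {v}" by auto
      with \<tau>(2) show False by simp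
    qed
    have below: "\<tau> - {v} \<subseteq> \<sigma>" using \<tau> by auto
    have "\<forall>\<sigma>\<in>A. \<forall>\<tau>. \<tau> \<noteq> {} \<and> \<tau> \<subseteq> \<sigma> \<longrightarrow> \<tau> \<in> A"
      using A unfolding subcomplex_def abstract_simplicial_complex_def by (elim conjE)
    from this[rule_format, OF \<open>\<sigma> \<in> A\<close> conjI[OF nonempty below]] have "\<tau> - {v} \<in> A" .
    then have "insert v (\<tau> - {v}) \<in> F" using F by blast
    then show ?thesis using True by (simp add: insert_absorb)
  qed
  then have "insert v \<sigma> \<in> ?X"
    using \<sigma> assms(2) by (auto simp: spanned_complex_def)
  then show "\<sigma> \<in> link ?X v \<inter> ?XU"
    using \<sigma> assms(2) by (auto simp: link_def induced_subcomplex_def)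
qed

lemma ample_spanned_complex:
  assumes "finite V" "V \<noteq> {}" "r \<le> card V" "realises_patterns r V F"
  shows "ample r (spanned_complex V F)"
proof -
  let ?X = "spanned_complex V F"
  have "abstract_simplicial_complex ?X"
    unfolding abstract_simplicial_complex_def spanned_complex_def
    using assms(1) by (auto intro: finite_subset)
  moreover have "?X \<noteq> {}"
    using assms(2) vertices_spanned_complex[of V F] by (auto simp: vertices_def)
  moreover have "\<exists>v\<in>V - U. link ?X v \<inter> induced_subcomplex ?X U = A"
    if U: "U \<subseteq> V" "card U \<le> r" and A: "subcomplex A (induced_subcomplex ?X U)" for U A
  proof -
    \<comment> \<open>Patterns are realised only over sets of exactly \<open>r\<close> elements, so
      \<open>U\<close> is enlarged. The link condition over \<open>U'\<close> restricts to
      \<open>U\<close> because \<open>A\<close> already lies over \<open>U\<close>.\<close>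
    obtain U' where U': "U \<subseteq> U'" "U' \<subseteq> V" "card U' = r"
      using exists_subset_between[OF U(2) assms(3) U(1) assms(1)] by blast
    have A': "subcomplex A (induced_subcomplex ?X U')"
      using A U'(1) by (auto simp: subcomplex_def induced_subcomplex_def)
    have "A \<subseteq> Pow U' - {{}}"
      using A' by (auto simp: subcomplex_def induced_subcomplex_def spanned_complex_def)
    then obtain v where v: "v \<in> V - U'" "F \<inter> extension_block U' v = insert v ` A"
      using assms(4) U' unfolding realises_patterns_def by blast
    have "link ?X v \<inter> induced_subcomplex ?X U' = A"
      using link_spanned_complex[OF _ v(1) A' v(2)] U'(2) assms(1) finite_subset by blast
    moreover have "A \<subseteq> induced_subcomplex ?X U" using A by (simp add: subcomplex_def)
    moreover have "induced_subcomplex ?X U \<subseteq> induced_subcomplex ?X U'"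
      using U'(1) by (auto simp: induced_subcomplex_def)
    ultimately have "link ?X v \<inter> induced_subcomplex ?X U = A" by blast
    then show ?thesis using v(1) U'(1) by blast
  qed
  ultimately show ?thesis
    unfolding ample_def vertices_spanned_complex by blast
qed

section \<open>The numerical estimate\<close>

lemma four_mult_le_power2:
  fixes r :: nat
  assumes "r \<ge> 4"
  shows "4 * r \<le> 2 ^ r"
  using assms by (induction r rule: dec_induct) auto

text \<open>After taking logarithms and using \<open>1 - x \<le> exp (- x)\<close>, it suffices that
  \<open>r * ln n + m * ln 2 < (n - r) / 2 ^ m\<close>. Writing \<open>n = t * N\<close> with
  \<open>t \<ge> 1\<close>, both sides are compared through bounds linear in
  \<open>t\<close>.\<close>

lemma union_bound_small:
  fixes r n :: nat
  assumes r: "r \<ge> 5" and n: "n \<ge> r * 2 ^ r * 2 ^ (2 ^ r)"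
  shows "real n ^ r * 2 ^ (2 ^ r - 1) * (1 - 1 / 2 ^ (2 ^ r - 1)) ^ (n - r) < 1"
proof -
  define m where "m = (2::nat) ^ r - 1"
  define K where "K = (2::real) ^ r"
  define N where "N = real r * K * 2 ^ (2 ^ r)"
  define t where "t = real n / N"
  have "real (4 * r) \<le> real (2 ^ r)"
    using four_mult_le_power2[of r] r by (intro of_nat_mono) simp
  then have K: "K \<ge> 4 * real r" by (simp add: K_def)
  have mK: "real m = K - 1" by (simp add: m_def K_def of_nat_diff)
  have "(2::nat) ^ r = Suc m" by (simp add: m_def)
  then have m2: "(2::real) ^ (2 ^ r) = 2 * 2 ^ m" by simp
  have r0: "real r \<ge> 5" using r by simp
  have N0: "N > 0" using r0 K by (simp add: N_def)
  have "real n \<ge> real (r * 2 ^ r * 2 ^ (2 ^ r))" using n by (rule of_nat_mono)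
  then have nN: "real n \<ge> N" by (simp add: N_def K_def)
  have t1: "t \<ge> 1" using nN N0 by (simp add: t_def)
  have n0: "real n > 0" using nN N0 by linarith
  have "r * 1 \<le> r * (2 ^ r * 2 ^ (2 ^ r))" by (intro mult_le_mono2) simp
  then have rn: "r \<le> n" using n unfolding mult.assoc by linarith
  have ln2: "ln (2::real) \<le> 1" using ln_le_minus_one[of "2::real"] by simp
  have "ln (real r) \<le> ln K" using K r0 by simp
  also have lnK: "ln K = real r * ln 2" by (simp add: K_def ln_realpow)
  also have "\<dots> \<le> real r" using ln2 by (intro mult_left_le) auto
  finally have lnr: "ln (real r) \<le> real r" .
  have "ln N = ln (real r) + ln K + ln (2 ^ (2 ^ r))"
    using r0 K by (simp add: N_def ln_mult)
  also have "ln ((2::real) ^ (2 ^ r)) = K * ln 2" by (simp add: K_def ln_realpow)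
  also have "\<dots> \<le> K" using ln2 K by (intro mult_left_le) auto
  finally have lnN: "ln N \<le> 2 * real r + K"
    using lnr lnK mult_left_le[of "ln 2" "real r"] ln2 by linarith
  \<comment> \<open>Replacing \<open>ln t\<close> by \<open>t - 1\<close> makes the bound linear in
    \<open>t\<close> and loses nothing at \<open>t = 1\<close>.\<close>
  have "ln (real n) = ln t + ln N" using N0 n0 by (simp add: t_def ln_div)
  also have "\<dots> \<le> (t - 1) + (2 * real r + K)"
    using lnN ln_le_minus_one[of t] t1 by linarith
  finally have lnn: "real r * ln (real n) \<le> real r * ((t - 1) + (2 * real r + K))"
    by (rule mult_left_mono) simp
  have "real m * ln 2 \<le> real m" using ln2 by (intro mult_left_le) auto
  then have lnm: "real m * ln 2 \<le> K - 1" using mK by simp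
  have quot: "real (n - r) / 2 ^ m \<ge> 2 * real r * K * t - real r"
  proof -
    have "real n / 2 ^ m = 2 * real r * K * t"
      using N0 r0 K by (simp add: t_def N_def m2 field_simps)
    moreover have "real r / 2 ^ m \<le> real r" by (simp add: divide_le_eq mult_le_cancel_left1)
    ultimately show ?thesis using rn by (simp add: of_nat_diff diff_divide_distrib)
  qed
  \<comment> \<open>The difference of the two linear bounds has positive slope
    \<open>r * (2 * K - 1)\<close>, so \<open>t = 1\<close> is the worst case.\<close>
  have "(real r * (2 * K - 1)) * 1 \<le> (real r * (2 * K - 1)) * t"
    using t1 K r0 by (intro mult_left_mono) auto
  then have lin: "2 * real r * K * t - real r * t \<ge> 2 * real r * K - real r"
    by (simp add: algebra_simps)
  \<comment> \<open>At \<open>t = 1\<close> the claim becomes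
    \<open>2 * r * r + r + K < r * K + 1\<close>, which follows from \<open>K \<ge> 4 * r\<close>
    and \<open>r \<ge> 5\<close>.\<close>
  have "(real r - 1) * (4 * real r) \<le> (real r - 1) * K"
    using K r0 by (intro mult_left_mono) auto
  moreover have "5 * real r \<le> real r * real r" using r0 by (intro mult_right_mono) auto
  ultimately have "2 * (real r * real r) + real r + K < real r * K + 1"
    using r0 unfolding left_diff_distrib right_diff_distrib mult.left_commute[of "real r" 4]
    by linarith
  with lin have exponent: "real r * ln (real n) + real m * ln 2 < real (n - r) / 2 ^ m"
    using lnn lnm quot by (simp add: algebra_simps)
  have "(1 - 1 / 2 ^ m :: real) \<le> exp (- (1 / 2 ^ m))"
    using exp_ge_add_one_self[of "- (1 / 2 ^ m) :: real"] by simp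
  then have "(1 - 1 / 2 ^ m :: real) ^ (n - r) \<le> exp (- (1 / 2 ^ m)) ^ (n - r)"
    by (rule power_mono) simp
  also have "\<dots> = exp (- (real (n - r) / 2 ^ m))"
    by (simp flip: exp_of_nat_mult)
  finally have bound: "(1 - 1 / 2 ^ m :: real) ^ (n - r) \<le> exp (- (real (n - r) / 2 ^ m))" .
  have expand: "real n ^ r * 2 ^ m = exp (real r * ln (real n) + real m * ln 2)"
    using n0 by (simp add: exp_add exp_of_nat_mult)
  have "real n ^ r * 2 ^ m * (1 - 1 / 2 ^ m) ^ (n - r)
      \<le> real n ^ r * 2 ^ m * exp (- (real (n - r) / 2 ^ m))"
    by (rule mult_left_mono[OF bound]) simp
  also have "\<dots> = exp (real r * ln (real n) + real m * ln 2 - real (n - r) / 2 ^ m)"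
    unfolding expand by (simp flip: exp_add)
  also have "\<dots> < 1" using exponent by simp
  finally show ?thesis unfolding m_def .
qed

theorem proposition5p4:
  fixes r n :: nat
  assumes "r \<ge> 5" and "n \<ge> r * 2 ^ r * 2 ^ (2 ^ r)"
  shows "\<exists>X :: nat set set. ample r X \<and> finite (vertices X) \<and> card (vertices X) = n"
proof -
  \<comment> \<open>Having \<open>r \<le> n\<close> guarantees that smaller vertex sets can be
    enlarged to \<open>r\<close> elements.\<close>
  have "r * 1 \<le> r * (2 ^ r * 2 ^ (2 ^ r))" by (intro mult_le_mono2) simp
  then have rn: "r \<le> n" using assms(2) unfolding mult.assoc by linarith
  obtain F where F: "realises_patterns r {..<n} F"
    using exists_realising_family[of "{..<n}" r] union_bound_small[OF assms] by auto
  have "0 \<in> {..<n}" using assms(1) rn by simp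
  then have "{..<n} \<noteq> {}" by blast
  then have "ample r (spanned_complex {..<n} F)"
    using F rn by (intro ample_spanned_complex) auto
  then show ?thesis
    using vertices_spanned_complex[of "{..<n}" F] by auto
qed

end
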